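(* $\mathrm{BMO}^d\subset\left(F^{02d}_1\right)^*$. More precisely, for every $\varphi\in\mathrm{BMO}^d$ and every $f\in F^{02d}_1$, $$\sum_{J\in D}|(f,h_J)|\,|(\varphi,h_J)|=\frac14\sum_{J\in D}|J|\,\left|\langle f\rangle_{J_+}-\langle f\rangle_{J_-}\right|\,\left|\langle\varphi\rangle_{J_+}-\langle\varphi\rangle_{J_-}\right|\le\frac{\sqrt2}4\,\|\varphi\|_{\mathrm{BMO}^d}\,\|f\|_{F^{02d}_1},$$ so that each $\varphi\in\mathrm{BMO}^d$ defines a continuous linear functional $f\mapsto\sum_{J\in D}(f,h_J)(\varphi,h_J)$ on $F^{02d}_1$.
   Context: $\mathbb T$ is the unit circle with arc length measure $d\theta$ normalized so that $|\mathbb T|=1$. All functions are real-valued. $D=D_{\mathbb T}$ is the dyadic lattice on $\mathbb T$: it contains $\mathbb T$ itself and, with each arc $I$, its left and right halves $I_-$ and $I_+$ (so the lengths are $|I|=2^{-k}$, $k\ge 0$). For $f\in L^1(\mathbb T)$ and $I\in D$ put $\langle f\rangle_I=\frac1{|I|}\int_I f(\theta)\,d\theta$. The Haar function $h_I$ equals $|I|^{-1/2}$ on $I_-$, $-|I|^{-1/2}$ on $I_+$ and $0$ elsewhere, and $(f,h_I)=\int_{\mathbb T} f h_I\,d\theta=\frac{\sqrt{|I|}}2\left(\langle f\rangle_{I_-}-\langle f\rangle_{I_+}\right)$. The dyadic Triebel-Lizorkin space $F^{02d}_1$ is the space of all $f\in L^1(\mathbb T)$ with $$\|f\|_{F^{02d}_1}=\int_{\mathbb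 T}\Bigl(\sum_{I\ni\theta,\,I\in D}\left(\langle f\rangle_{I_+}-\langle f\rangle_{I_-}\right)^2\Bigr)^{1/2}d\theta<\infty$$ (constants have norm zero), and $(F^{02d}_1)^*$ is the space of linear functionals that are continuous with respect to this norm. $\mathrm{BMO}^d$ is the space of all $\varphi\in L^1(\mathbb T)$ with $$\|\varphi\|_{\mathrm{BMO}^d}=\sup_{J\in D}\Bigl(\frac1{|J|}\sum_{I\in D,\,I\subset J}\left(\langle \varphi\rangle_{I_+}-\langle \varphi\rangle_{I_-}\right)^2|I|\Bigr)^{1/2}<\infty .$$ *)

theory Defs
  imports "HOL-Analysis.Analysis"
begin

text \<open>
  Arc length on the unit circle, with total mass 1. The completion makes
  integrability refer to Lebesgue (not only Borel) measurable functions.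
\<close>

definition circle_measure :: "complex measure" where
  "circle_measure =
     completion (distr (restrict_space lborel {0..<1::real}) (restrict_space borel (sphere 0 1))
       (\<lambda>t. cis (2 * pi * t)))"

text \<open>
  An arc of the dyadic lattice is encoded by a pair \<open>(n, k)\<close> with \<open>k < 2 ^ n\<close>, standing for the
  half-open arc of all points with normalized angle in \<open>[k / 2^n, (k + 1) / 2^n)\<close>. The encoding is
  injective on the lattice; it gives access to the halves of an arc without choosing endpoints.
  Left and right are taken in the direction of increasing angle.
\<close>

type_synonym dyadic = "nat \<times> nat"

fun arc_of :: "dyadic \<Rightarrow> complex set" where
  "arc_of (n, k) = (\<lambda>t. cis (2 * pi * t)) ` {real k / 2 ^ n ..< (real k + 1) / 2 ^ n}"

fun left_half :: "dyadic \<Rightarrow> dyadic" where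
  "left_half (n, k) = (Suc n, 2 * k)"

fun right_half :: "dyadic \<Rightarrow> dyadic" where
  "right_half (n, k) = (Suc n, 2 * k + 1)"

inductive_set dyadic_lattice :: "dyadic set" where
  whole: "(0, 0) \<in> dyadic_lattice"
| left: "I \<in> dyadic_lattice \<Longrightarrow> left_half I \<in> dyadic_lattice"
| right: "I \<in> dyadic_lattice \<Longrightarrow> right_half I \<in> dyadic_lattice"

definition arc_len :: "dyadic \<Rightarrow> real" where
  "arc_len I = measure circle_measure (arc_of I)"

definition avg :: "(complex \<Rightarrow> real) \<Rightarrow> dyadic \<Rightarrow> real" where
  "avg f I = (1 / arc_len I) * (LINT \<theta>:arc_of I|circle_measure. f \<theta>)"

definition haar :: "dyadic \<Rightarrow> complex \<Rightarrow> real" where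
  "haar I \<theta> =
     (if \<theta> \<in> arc_of (left_half I) then 1 / sqrt (arc_len I)
      else if \<theta> \<in> arc_of (right_half I) then - 1 / sqrt (arc_len I)
      else 0)"

definition haar_coeff :: "(complex \<Rightarrow> real) \<Rightarrow> dyadic \<Rightarrow> real" where
  "haar_coeff f I = (LINT \<theta>|circle_measure. f \<theta> * haar I \<theta>)"

definition ennsqrt :: "ennreal \<Rightarrow> ennreal" where
  "ennsqrt x = (if x = top then top else ennreal (sqrt (enn2real x)))"

text \<open>
  The two norms are \<open>ennreal\<close>-valued, so that a divergent sum, integral or supremum has the
  value \<open>top\<close>. They are seminorms on functions: functions that agree almost everywhere are not
  identified, but they have the same averages and Haar coefficients.
\<close>

definition F1_norm :: "(complex \<Rightarrow> real) \<Rightarrow> ennreal" where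
  "F1_norm f =
     (\<integral>\<^sup>+\<theta>. ennsqrt (\<Sum>\<^sub>\<infinity>I\<in>{I \<in> dyadic_lattice. \<theta> \<in> arc_of I}.
        ennreal ((avg f (right_half I) - avg f (left_half I))\<^sup>2)) \<partial>circle_measure)"

definition F1_space :: "(complex \<Rightarrow> real) set" where
  "F1_space = {f. integrable circle_measure f \<and> F1_norm f < top}"

definition BMOd_norm :: "(complex \<Rightarrow> real) \<Rightarrow> ennreal" where
  "BMOd_norm \<phi> =
     (SUP J\<in>dyadic_lattice. ennsqrt (ennreal (1 / arc_len J) *
        (\<Sum>\<^sub>\<infinity>I\<in>{I \<in> dyadic_lattice. arc_of I \<subseteq> arc_of J}.
           ennreal ((avg \<phi> (right_half I) - avg \<phi> (left_half I))\<^sup>2 * arc_len I))))"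

definition BMOd_space :: "(complex \<Rightarrow> real) set" where
  "BMOd_space = {\<phi>. integrable circle_measure \<phi> \<and> BMOd_norm \<phi> < top}"

text \<open>Only the values of a functional on \<open>F1_space\<close> matter.\<close>

definition F1_dual :: "((complex \<Rightarrow> real) \<Rightarrow> real) set" where
  "F1_dual = {L.
     (\<forall>f\<in>F1_space. \<forall>g\<in>F1_space. L (\<lambda>\<theta>. f \<theta> + g \<theta>) = L f + L g) \<and>
     (\<forall>c. \<forall>f\<in>F1_space. L (\<lambda>\<theta>. c * f \<theta>) = c * L f) \<and>
     (\<forall>f\<in>F1_space. \<forall>\<epsilon>>0. \<exists>\<delta>>0. \<forall>g\<in>F1_space.
        F1_norm (\<lambda>\<theta>. g \<theta> - f \<theta>) < ennreal \<delta> \<longrightarrow> \<bar>L g - L f\<bar> < \<epsilon>)}"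

end

theory Submission
  imports Defs
begin

text \<open>
  Fix \<open>f\<close> and \<open>\<phi>\<close> and let \<open>a\<close> and \<open>b\<close> be the absolute values of the jumps of their means across the
  midpoint of an arc. By \<open>abs_haar_coeff_mult\<close> the product of the Haar coefficients at \<open>J\<close> is in absolute
  value a quarter of \<open>|J| a b\<close>, so the task is to bound the sum of \<open>|J| a b\<close> by
  \<open>sqrt 2 * BMOd_norm \<phi> * F1_norm f\<close>.

  For an arc \<open>J\<close> let \<open>S J\<close> be the square root of the sum of \<open>a\<^sup>2\<close> over \<open>J\<close> and all its ancestors, the
  square function of \<open>f\<close> truncated at \<open>J\<close>. Cauchy-Schwarz with the weight \<open>S\<close> bounds the square of the
  sum by the product of two sums, that of \<open>|J| a\<^sup>2 / S\<close> and that of \<open>|J| b\<^sup>2 S\<close>. Both are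
  controlled by the increments of \<open>S\<close> from an arc to its halves. In the first one, \<open>a\<^sup>2\<close> is the increment
  of \<open>S\<^sup>2\<close>, so \<open>a\<^sup>2 / S\<close> is at most twice the increment of \<open>S\<close>, and the sum telescopes to
  at most twice the integral of the square function (\<open>sum_energy_over_path_sqrt_le\<close>). In the second one,
  \<open>S\<close> is the sum of its increments; after an exchange of the sums the increment at \<open>K\<close> meets the total of
  \<open>|J| b\<^sup>2\<close> over \<open>J\<close> inside \<open>K\<close>, which the BMO condition bounds by \<open>(BMOd_norm \<phi>)\<^sup>2 |K|\<close>
  (\<open>sum_path_sqrt_Carleson_le\<close>). The product is at most
  \<open>2 (BMOd_norm \<phi>)\<^sup>2 (F1_norm f)\<^sup>2\<close>, and the factor 2 becomes the \<open>sqrt 2\<close> of the claim.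

  The argument is carried out on the first \<open>N\<close> levels of the tree (\<open>dyadic_duality\<close>), where all sums are
  finite; \<open>level_mean_le_F1_norm\<close> bounds the integral of the truncated square function by the norm of \<open>f\<close>.
  Linearity of the functional follows from absolute convergence, and continuity from the bound.
\<close>

section \<open>The duality estimate on the dyadic tree\<close>

lemma sum_children:
  fixes g :: "nat \<Rightarrow> real"
  shows "(\<Sum>k<2 ^ Suc n. g k) = (\<Sum>k<2 ^ n. g (2 * k) + g (2 * k + 1))"
proof -
  have "(\<Sum>k<2 * m. g k) = (\<Sum>k<m. g (2 * k) + g (2 * k + 1))" for m
    by (induction m) (auto simp: algebra_simps)
  then show ?thesis by simp
qed

text \<open>
  For \<open>a\<close> the sequence of jumps of \<open>f\<close>, \<open>path_sqrt a J\<close> is the square function of \<open>f\<close> truncated at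
  the arc \<open>J\<close>: only \<open>J\<close> and its ancestors contribute, so that it is constant on \<open>J\<close>. The ancestor of
  \<open>(n, k)\<close> at level \<open>j\<close> is \<open>(j, k div 2^(n-j))\<close>.
\<close>
definition path_sqrt :: "(dyadic \<Rightarrow> real) \<Rightarrow> dyadic \<Rightarrow> real" where
  "path_sqrt a J = sqrt (\<Sum>j\<le>fst J. (a (j, snd J div 2 ^ (fst J - j)))\<^sup>2)"

lemma path_sqrt_nonneg [simp]: "0 \<le> path_sqrt a J"
  by (simp add: path_sqrt_def sum_nonneg)

lemma path_sqrt_root: "path_sqrt a (0, k) = \<bar>a (0, k)\<bar>"
  by (simp add: path_sqrt_def)

lemma path_sqrt_Suc: "(path_sqrt a (Suc n, k))\<^sup>2 = (path_sqrt a (n, k div 2))\<^sup>2 + (a (Suc n, k))\<^sup>2"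
proof -
  have "k div 2 ^ (Suc n - j) = k div 2 div 2 ^ (n - j)" if "j \<le> n" for j
    using that by (simp add: Suc_diff_le div_mult2_eq)
  then show ?thesis
    by (simp add: path_sqrt_def sum_nonneg)
qed

lemma path_sqrt_mono: "path_sqrt a (n, k div 2) \<le> path_sqrt a (Suc n, k)"
  by (rule power2_le_imp_le) (simp_all add: path_sqrt_Suc)

text \<open>
  A vanishing \<open>path_sqrt a J\<close> forces \<open>a J = 0\<close>, so dividing by it loses no term.
\<close>
lemma abs_le_path_sqrt: "\<bar>a J\<bar> \<le> path_sqrt a J"
proof (cases J)
  case (Pair n k)
  then show ?thesis
    by (cases n) (auto simp: path_sqrt_root path_sqrt_Suc intro!: power2_le_imp_le[of "\<bar>_\<bar>"])
qed

text \<open>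
  The integral over the circle of the function with the constant value \<open>g J\<close> on each arc \<open>J\<close> of
  level \<open>n\<close>.
\<close>
definition level_mean :: "(dyadic \<Rightarrow> real) \<Rightarrow> nat \<Rightarrow> real" where
  "level_mean g n = (\<Sum>k<2 ^ n. g (n, k) / 2 ^ n)"

lemma level_mean_parent:
  "level_mean g n = (\<Sum>k<2 ^ Suc n. g (n, k div 2) / 2 ^ Suc n)"
proof -
  have "(\<Sum>k<2 ^ Suc n. g (n, k div 2) / 2 ^ Suc n)
      = (\<Sum>k<2 ^ n. g (n, (2 * k) div 2) / 2 ^ Suc n + g (n, (2 * k + 1) div 2) / 2 ^ Suc n)"
    by (rule sum_children)
  also have "\<dots> = level_mean g n"
    by (simp add: level_mean_def)
  finally show ?thesis by simp
qed

text \<open>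
  With \<open>S\<close> the truncated square function at an arc and \<open>P\<close> the one at its parent,
  \<open>a\<^sup>2 = S\<^sup>2 - P\<^sup>2 = (S - P) (S + P) \<le> 2 S (S - P)\<close>, so that \<open>a\<^sup>2 / S \<le> 2 (S - P)\<close>. The mean of
  \<open>P\<close> over a level is the mean of \<open>S\<close> over the previous one, and the sum over the levels telescopes.
  The factor 2 is the source of the \<open>sqrt 2\<close> in the duality constant.
\<close>
lemma sum_energy_over_path_sqrt_le:
  "(\<Sum>n\<le>N. level_mean (\<lambda>J. (a J)\<^sup>2 / path_sqrt a J) n) \<le> 2 * level_mean (path_sqrt a) N"
proof (induction N)
  case 0
  have "(a (0, 0))\<^sup>2 / path_sqrt a (0, 0) = \<bar>a (0, 0)\<bar>"
    by (simp add: path_sqrt_root power2_eq_square abs_if)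
  then show ?case
    by (simp add: level_mean_def path_sqrt_root)
next
  case (Suc N)
  let ?S = "\<lambda>k. path_sqrt a (Suc N, k)" and ?P = "\<lambda>k. path_sqrt a (N, k div 2)"
  have "(a (Suc N, k))\<^sup>2 / ?S k \<le> 2 * (?S k - ?P k)" for k
  proof (cases "?S k = 0")
    case False
    then have "0 < ?S k" by (simp add: less_le)
    moreover have "(a (Suc N, k))\<^sup>2 = (?S k - ?P k) * (?S k + ?P k)"
      using path_sqrt_Suc[of a N k] by (simp add: power2_eq_square algebra_simps)
    moreover have "(?S k - ?P k) * (?S k + ?P k) \<le> (?S k - ?P k) * (2 * ?S k)"
      using path_sqrt_mono[of a N k] by (intro mult_left_mono) auto
    ultimately show ?thesis
      by (simp only: pos_divide_le_eq)
  qed (use path_sqrt_mono[of a N k] in simp)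
  then have "level_mean (\<lambda>J. (a J)\<^sup>2 / path_sqrt a J) (Suc N)
      \<le> (\<Sum>k<2 ^ Suc N. 2 * (?S k - ?P k) / 2 ^ Suc N)"
    unfolding level_mean_def by (intro sum_mono divide_right_mono) auto
  also have "\<dots> = 2 * ((\<Sum>k<2 ^ Suc N. ?S k / 2 ^ Suc N) - (\<Sum>k<2 ^ Suc N. ?P k / 2 ^ Suc N))"
    by (simp only: sum_subtractf[symmetric] sum_distrib_left) (simp add: diff_divide_distrib)
  also have "\<dots> = 2 * (level_mean (path_sqrt a) (Suc N) - level_mean (path_sqrt a) N)"
    by (simp only: level_mean_parent[of _ N] level_mean_def[of _ "Suc N"])
  finally show ?case using Suc by simp
qed

text \<open>
  Summation by parts on the tree. Here \<open>T J\<close> bounds the sum of \<open>b\<^sup>2\<close> times length over all arcs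
  inside \<open>J\<close>. Writing \<open>S J\<close> as the sum of its increments along the ancestors of \<open>J\<close> and exchanging the
  sums, each increment at \<open>K\<close> is multiplied by at most \<open>T K\<close>, hence by at most \<open>C\<close> times the length of
  \<open>K\<close>, and what remains is the telescoping sum of the increments of \<open>S\<close>.
\<close>
lemma sum_path_sqrt_Carleson_le:
  fixes T :: "dyadic \<Rightarrow> real"
  assumes mass: "\<And>n k. k < 2 ^ n \<Longrightarrow>
      (b (n, k))\<^sup>2 / 2 ^ n + T (Suc n, 2 * k) + T (Suc n, 2 * k + 1) \<le> T (n, k)"
    and nonneg: "\<And>J. 0 \<le> T J"
    and Carleson: "\<And>n k. k < 2 ^ n \<Longrightarrow> T (n, k) \<le> C / 2 ^ n"
  shows "(\<Sum>n\<le>N. level_mean (\<lambda>J. (b J)\<^sup>2 * path_sqrt a J) n) \<le> C * level_mean (path_sqrt a) N"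
proof -
  let ?S = "path_sqrt a"
  let ?E = "level_mean (\<lambda>J. (b J)\<^sup>2 * ?S J)"
  let ?R = "\<lambda>n. \<Sum>k<2 ^ n. ?S (n, k) * T (n, k)"
  \<comment> \<open>\<open>?R n\<close> bounds the sum over the levels from \<open>n\<close> on when \<open>S\<close> is replaced there by its
    value at the ancestor of level \<open>n\<close>. Passing to level \<open>n + 1\<close> splits off the terms of level
    \<open>n\<close> and adds the increments of \<open>S\<close>.\<close>
  have root: "?R 0 \<le> C * level_mean ?S 0"
    using Carleson[of 0 0] by (simp add: level_mean_def mult.commute mult_right_mono)
  have step: "?E n + ?R (Suc n) - ?R n \<le> C * (level_mean ?S (Suc n) - level_mean ?S n)" for n
  proof -
    have "?E n + (\<Sum>k<2 ^ Suc n. ?S (n, k div 2) * T (Suc n, k))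
        = (\<Sum>k<2 ^ n. ?S (n, k) * ((b (n, k))\<^sup>2 / 2 ^ n + T (Suc n, 2 * k) + T (Suc n, 2 * k + 1)))"
      unfolding sum_children by (simp add: level_mean_def sum.distrib algebra_simps)
    also have "\<dots> \<le> ?R n"
      by (intro sum_mono mult_left_mono mass) auto
    finally have 1: "?E n + (\<Sum>k<2 ^ Suc n. ?S (n, k div 2) * T (Suc n, k)) \<le> ?R n" .
    have "?R (Suc n) - (\<Sum>k<2 ^ Suc n. ?S (n, k div 2) * T (Suc n, k))
        = (\<Sum>k<2 ^ Suc n. (?S (Suc n, k) - ?S (n, k div 2)) * T (Suc n, k))"
      by (simp only: sum_subtractf[symmetric] left_diff_distrib)
    also have "\<dots> \<le> (\<Sum>k<2 ^ Suc n. (?S (Suc n, k) - ?S (n, k div 2)) * (C / 2 ^ Suc n))"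
      by (intro sum_mono mult_left_mono Carleson) (use path_sqrt_mono[of a n] in auto)
    also have "\<dots> = C * ((\<Sum>k<2 ^ Suc n. ?S (Suc n, k) / 2 ^ Suc n)
        - (\<Sum>k<2 ^ Suc n. ?S (n, k div 2) / 2 ^ Suc n))"
      by (simp only: sum_subtractf[symmetric] sum_distrib_left) (simp add: field_simps)
    also have "\<dots> = C * (level_mean ?S (Suc n) - level_mean ?S n)"
      by (simp only: level_mean_parent[of _ n] level_mean_def[of _ "Suc n"])
    finally show ?thesis using 1 by linarith
  qed
  have invariant: "(\<Sum>m<n. ?E m) + ?R n \<le> C * level_mean ?S n" for n
  proof (induction n)
    case 0
    then show ?case using root by simp
  next
    case (Suc n)
    then show ?case using step[of n] by (simp add: algebra_simps)
  qed
  have "?E N \<le> ?R N"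
  proof -
    have "(b (N, k))\<^sup>2 / 2 ^ N \<le> T (N, k)" if "k < 2 ^ N" for k
      using mass[OF that] nonneg[of "(Suc N, 2 * k)"] nonneg[of "(Suc N, 2 * k + 1)"] by simp
    then have "?S (N, k) * ((b (N, k))\<^sup>2 / 2 ^ N) \<le> ?S (N, k) * T (N, k)" if "k < 2 ^ N" for k
      using that by (intro mult_left_mono) auto
    then show ?thesis
      unfolding level_mean_def by (intro sum_mono) (auto simp: mult_ac)
  qed
  then show ?thesis
    using invariant[of N] by (simp add: lessThan_Suc_atMost[symmetric] del: lessThan_Suc_atMost)
qed

text \<open>
  Cauchy-Schwarz with the weight \<open>S\<close>, the truncated square function: \<open>|a b| = (|a| / sqrt S) (|b| sqrt S)\<close>.
  The two resulting sums are those of \<open>sum_energy_over_path_sqrt_le\<close> and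
  \<open>sum_path_sqrt_Carleson_le\<close>.
\<close>
lemma dyadic_duality:
  fixes T :: "dyadic \<Rightarrow> real"
  assumes mass: "\<And>n k. k < 2 ^ n \<Longrightarrow>
      (b (n, k))\<^sup>2 / 2 ^ n + T (Suc n, 2 * k) + T (Suc n, 2 * k + 1) \<le> T (n, k)"
    and nonneg: "\<And>J. 0 \<le> T J"
    and Carleson: "\<And>n k. k < 2 ^ n \<Longrightarrow> T (n, k) \<le> B\<^sup>2 / 2 ^ n"
    and "0 \<le> B"
  shows "(\<Sum>n\<le>N. level_mean (\<lambda>J. \<bar>a J\<bar> * \<bar>b J\<bar>) n) \<le> sqrt 2 * B * level_mean (path_sqrt a) N"
proof -
  let ?S = "path_sqrt a"
  let ?A = "Sigma {..N} (\<lambda>n. {..<2 ^ n})"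
  let ?u = "\<lambda>(n, k). \<bar>a (n, k)\<bar> / sqrt (?S (n, k) * 2 ^ n)"
  let ?v = "\<lambda>(n, k). \<bar>b (n, k)\<bar> * sqrt (?S (n, k) / 2 ^ n)"
  have flat: "(\<Sum>n\<le>N. level_mean g n) = (\<Sum>(n, k)\<in>?A. g (n, k) / 2 ^ n)" for g
    unfolding level_mean_def by (rule sum.Sigma) auto
  have uv: "\<bar>a J\<bar> * \<bar>b J\<bar> / 2 ^ n = (\<bar>a J\<bar> / sqrt (?S J * 2 ^ n)) * (\<bar>b J\<bar> * sqrt (?S J / 2 ^ n))"
    for J n
  proof (cases "?S J = 0")
    case True
    then show ?thesis using abs_le_path_sqrt[of a J] by simp
  next
    case False
    have "sqrt (2 ^ n :: real) * sqrt (2 ^ n) = 2 ^ n" by simp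
    with False show ?thesis
      by (simp add: real_sqrt_mult real_sqrt_divide divide_simps)
  qed
  have "((\<Sum>n\<le>N. level_mean (\<lambda>J. \<bar>a J\<bar> * \<bar>b J\<bar>) n))\<^sup>2 = (\<Sum>J\<in>?A. ?u J * ?v J)\<^sup>2"
    unfolding flat by (intro arg_cong[where f = "\<lambda>x. x\<^sup>2"] sum.cong) (auto simp: uv)
  also have "\<dots> \<le> (\<Sum>J\<in>?A. (?u J)\<^sup>2) * (\<Sum>J\<in>?A. (?v J)\<^sup>2)"
    by (rule Cauchy_Schwarz_ineq_sum)
  also have "(\<Sum>J\<in>?A. (?u J)\<^sup>2) = (\<Sum>n\<le>N. level_mean (\<lambda>J. (a J)\<^sup>2 / ?S J) n)"
    unfolding flat by (intro sum.cong) (auto simp: power_divide)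
  also have "(\<Sum>J\<in>?A. (?v J)\<^sup>2) = (\<Sum>n\<le>N. level_mean (\<lambda>J. (b J)\<^sup>2 * ?S J) n)"
    unfolding flat by (intro sum.cong) (auto simp: power_mult_distrib)
  also have "(\<Sum>n\<le>N. level_mean (\<lambda>J. (a J)\<^sup>2 / ?S J) n) * (\<Sum>n\<le>N. level_mean (\<lambda>J. (b J)\<^sup>2 * ?S J) n)
      \<le> (2 * level_mean ?S N) * (B\<^sup>2 * level_mean ?S N)"
    by (intro mult_mono sum_energy_over_path_sqrt_le sum_path_sqrt_Carleson_le[OF mass nonneg Carleson])
      (auto simp: level_mean_def intro!: sum_nonneg)
  also have "\<dots> = (sqrt 2 * B * level_mean ?S N)\<^sup>2"
    by (simp add: power_mult_distrib power2_eq_square)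
  finally show ?thesis
    by (rule power2_le_imp_le) (use \<open>0 \<le> B\<close> in \<open>auto simp: level_mean_def intro!: mult_nonneg_nonneg sum_nonneg\<close>)
qed

section \<open>Dyadic arcs and their measure\<close>

lemma mem_dyadic_lattice_iff: "(n, k) \<in> dyadic_lattice \<longleftrightarrow> k < 2 ^ n"
proof
  have "snd I < 2 ^ fst I" if "I \<in> dyadic_lattice" for I
    using that by induction auto
  then show "(n, k) \<in> dyadic_lattice \<Longrightarrow> k < 2 ^ n" by force
  show "k < 2 ^ n \<Longrightarrow> (n, k) \<in> dyadic_lattice"
  proof (induction n arbitrary: k)
    case 0
    then show ?case by (simp add: dyadic_lattice.whole)
  next
    case (Suc n)
    then have I: "(n, k div 2) \<in> dyadic_lattice" by simp
    show ?case
      using dyadic_lattice.left[OF I] dyadic_lattice.right[OF I]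
      by (cases "even k") auto
  qed
qed

lemma circle_param_inj: "inj_on (\<lambda>t. cis (2 * pi * t)) {0..<1}"
proof (rule inj_onI)
  fix s t :: real
  assume st: "s \<in> {0..<1}" "t \<in> {0..<1}" and eq: "cis (2 * pi * s) = cis (2 * pi * t)"
  from eq have "\<exists>n::int. 2 * pi * s = 2 * pi * t + 2 * pi * n"
    by (subst sin_cos_eq_iff[symmetric]) (auto simp: complex_eq_iff)
  then obtain n :: int where "2 * pi * s = 2 * pi * (t + n)"
    by (auto simp: algebra_simps)
  then have "s = t + n" by simp
  with st have "real_of_int n < 1" "- 1 < real_of_int n" by auto
  then have "n = 0" by linarith
  with \<open>s = t + n\<close> show "s = t" by simp
qed

definition dyadic_ivl :: "dyadic \<Rightarrow> real set" where
  "dyadic_ivl J = {real (snd J) / 2 ^ fst J ..< (real (snd J) + 1) / 2 ^ fst J}"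

lemma arc_of_eq: "arc_of J = (\<lambda>t. cis (2 * pi * t)) ` dyadic_ivl J"
  by (cases J) (simp add: dyadic_ivl_def)

declare arc_of.simps [simp del]

lemma dyadic_ivl_subset: "J \<in> dyadic_lattice \<Longrightarrow> dyadic_ivl J \<subseteq> {0..<1}"
proof (cases J)
  case (Pair n k)
  assume "J \<in> dyadic_lattice"
  then have "k + 1 \<le> 2 ^ n" by (simp add: Pair mem_dyadic_lattice_iff)
  then have "real (k + 1) \<le> real (2 ^ n)" by (simp only: of_nat_le_iff)
  then have "(real k + 1) / 2 ^ n \<le> 1" by simp
  moreover have "0 \<le> real k / 2 ^ n" by simp
  ultimately show ?thesis
    unfolding Pair dyadic_ivl_def fst_conv snd_conv by (auto intro: order.trans less_le_trans)
qed

lemma dyadic_ivl_nonempty: "dyadic_ivl J \<noteq> {}"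
  by (simp add: dyadic_ivl_def divide_strict_right_mono not_le)

lemma arc_of_nonempty: "arc_of J \<noteq> {}"
  by (simp add: arc_of_eq dyadic_ivl_nonempty)

lemma dyadic_ivl_halves:
  "dyadic_ivl J = dyadic_ivl (left_half J) \<union> dyadic_ivl (right_half J)"
  by (cases J) (auto simp: dyadic_ivl_def field_simps)

text \<open>
  The index of the interval of level \<open>n\<close> that contains \<open>t\<close> is the integer part of \<open>t 2^n\<close>.
\<close>
lemma dyadic_ivl_disjoint:
  assumes "k \<noteq> l"
  shows "dyadic_ivl (n, k) \<inter> dyadic_ivl (n, l) = {}"
proof -
  have "\<lfloor>t * 2 ^ n\<rfloor> = int k" if "t \<in> dyadic_ivl (n, k)" for t and k
    using that by (auto simp: dyadic_ivl_def field_simps intro!: floor_unique)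
  from this[of _ k] this[of _ l] show ?thesis
    using assms by fastforce
qed

lemma arc_of_halves: "arc_of J = arc_of (left_half J) \<union> arc_of (right_half J)"
  using dyadic_ivl_halves[of J] by (simp add: arc_of_eq image_Un)

lemma arc_of_disjoint:
  assumes "k < 2 ^ n" "l < 2 ^ n" "k \<noteq> l"
  shows "arc_of (n, k) \<inter> arc_of (n, l) = {}"
  using assms dyadic_ivl_subset[of "(n, k)"] dyadic_ivl_subset[of "(n, l)"]
  unfolding arc_of_eq
  by (subst inj_on_image_Int[OF circle_param_inj, symmetric])
    (auto simp: mem_dyadic_lattice_iff dyadic_ivl_disjoint)

lemma halves_disjoint:
  assumes "J \<in> dyadic_lattice"
  shows "arc_of (left_half J) \<inter> arc_of (right_half J) = {}"
proof (cases J)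
  case (Pair n k)
  then show ?thesis
    using assms unfolding Pair left_half.simps right_half.simps
    by (intro arc_of_disjoint) (auto simp: mem_dyadic_lattice_iff)
qed

text \<open>
  A half-open interval is a countable union of compact intervals, so its continuous image is a
  countable union of compact sets. For the arcs this avoids inverting the parametrization of the
  circle, whose inverse is discontinuous at the end point.
\<close>
lemma borel_continuous_image_Ico:
  fixes f :: "real \<Rightarrow> 'a :: metric_space"
  assumes "continuous_on UNIV f"
  shows "f ` {a..<b} \<in> sets borel"
proof -
  have "{a..<b} = (\<Union>m. {a..b - 1 / real (Suc m)})"
  proof safe
    fix t assume t: "t \<in> {a..<b}"
    then obtain m where "1 / real (Suc m) < b - t"
      using reals_Archimedean[of "b - t"] by (auto simp: inverse_eq_divide)
    with t show "t \<in> (\<Union>m. {a..b - 1 / real (Suc m)})"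
      by (intro UN_I[of m]) auto
  next
    fix t m assume "t \<in> {a..b - 1 / real (Suc m)}"
    moreover have "b - 1 / real (Suc m) < b" by simp
    ultimately show "t \<in> {a..<b}" by (meson atLeastAtMost_iff atLeastLessThan_iff le_less_trans)
  qed
  then have "f ` {a..<b} = (\<Union>m. f ` {a..b - 1 / real (Suc m)})"
    by (simp only: image_UN)
  moreover have "f ` {a..c} \<in> sets borel" for c
    by (intro borel_compact compact_continuous_image continuous_on_subset[OF assms]) auto
  ultimately show ?thesis by auto
qed

text \<open>
  Since the parametrization is injective on \<open>[0, 1)\<close>, the preimage of an arc is exactly the
  dyadic interval that defines it.
\<close>
lemma
  assumes "J \<in> dyadic_lattice"
  shows sets_arc_of: "arc_of J \<in> sets circle_measure"
    and emeasure_arc_of: "emeasure circle_measure (arc_of J) = ennreal (1 / 2 ^ fst J)"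
proof -
  let ?e = "\<lambda>t. cis (2 * pi * t)"
  let ?M = "restrict_space lborel {0..<1::real}"
  let ?N = "restrict_space borel (sphere 0 1) :: complex measure"
  let ?D = "distr ?M ?N ?e"
  have cont: "continuous_on UNIV ?e"
    by (intro continuous_intros)
  have meas: "?e \<in> measurable ?M ?N"
    by (intro measurable_restrict_space1 measurable_restrict_space2)
      (use borel_measurable_continuous_onI[OF cont] in auto)
  have "arc_of J \<in> sets borel"
    unfolding arc_of_eq dyadic_ivl_def by (rule borel_continuous_image_Ico[OF cont])
  moreover have "arc_of J \<subseteq> sphere 0 1"
    by (auto simp: arc_of_eq)
  ultimately have N: "arc_of J \<in> sets ?N"
    by (auto simp: sets_restrict_space intro!: image_eqI[of _ _ "arc_of J"])
  then have D: "arc_of J \<in> sets ?D" by simp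
  then show "arc_of J \<in> sets circle_measure"
    unfolding circle_measure_def by (rule sets_completionI_sets)
  have sub: "dyadic_ivl J \<subseteq> {0..<1}"
    by (rule dyadic_ivl_subset[OF assms])
  have "t \<in> ?e -` arc_of J \<longleftrightarrow> t \<in> dyadic_ivl J" if "t \<in> {0..<1}" for t
    using inj_on_image_mem_iff[OF circle_param_inj that sub] by (simp only: arc_of_eq vimage_eq)
  then have "?e -` arc_of J \<inter> {0..<1} = dyadic_ivl J"
    using sub by blast
  then have pre: "?e -` arc_of J \<inter> space ?M = dyadic_ivl J"
    by (simp add: space_restrict_space)
  have "emeasure circle_measure (arc_of J) = emeasure ?D (arc_of J)"
    using D by (simp add: circle_measure_def)
  also have "\<dots> = emeasure ?M (dyadic_ivl J)"
    using pre by (simp add: emeasure_distr[OF meas N])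
  also have "\<dots> = emeasure lborel (dyadic_ivl J)"
    using sub by (intro emeasure_restrict_space) auto
  also have "\<dots> = ennreal (1 / 2 ^ fst J)"
    by (simp add: dyadic_ivl_def divide_right_mono diff_divide_distrib[symmetric])
  finally show "emeasure circle_measure (arc_of J) = ennreal (1 / 2 ^ fst J)" .
qed

lemma arc_len_eq: "J \<in> dyadic_lattice \<Longrightarrow> arc_len J = 1 / 2 ^ fst J"
  by (simp add: arc_len_def measure_def emeasure_arc_of)

section \<open>Haar coefficients\<close>

abbreviation avg_jump :: "(complex \<Rightarrow> real) \<Rightarrow> dyadic \<Rightarrow> real" where
  "avg_jump f J \<equiv> avg f (right_half J) - avg f (left_half J)"

lemma integrable_arc:
  fixes f :: "complex \<Rightarrow> real"
  assumes "integrable circle_measure f" "J \<in> dyadic_lattice"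
  shows "integrable circle_measure (\<lambda>\<theta>. indicator (arc_of J) \<theta> * f \<theta>)"
  using integrable_mult_indicator[OF sets_arc_of[OF assms(2)] assms(1)] by simp

lemma haar_mult_eq:
  fixes f :: "complex \<Rightarrow> real"
  assumes "J \<in> dyadic_lattice"
  shows "f \<theta> * haar J \<theta> = 1 / sqrt (arc_len J) *
    (indicator (arc_of (left_half J)) \<theta> * f \<theta> - indicator (arc_of (right_half J)) \<theta> * f \<theta>)"
  using halves_disjoint[OF assms] by (auto simp: haar_def indicator_def)

lemma integrable_mult_haar:
  fixes f :: "complex \<Rightarrow> real"
  assumes "integrable circle_measure f" "J \<in> dyadic_lattice"
  shows "integrable circle_measure (\<lambda>\<theta>. f \<theta> * haar J \<theta>)"
  unfolding haar_mult_eq[OF assms(2)]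
  by (intro integrable_mult_right Bochner_Integration.integrable_diff integrable_arc dyadic_lattice.intros assms)

text \<open>
  The minus sign comes from the orientation: the Haar function is positive on the left half, whereas
  the jump subtracts the left mean from the right one.
\<close>
lemma haar_coeff_eq:
  fixes f :: "complex \<Rightarrow> real"
  assumes "integrable circle_measure f" "J \<in> dyadic_lattice"
  shows "haar_coeff f J = - sqrt (arc_len J) / 2 * avg_jump f J"
proof -
  let ?l = "LINT \<theta>|circle_measure. indicator (arc_of (left_half J)) \<theta> * f \<theta>"
  let ?r = "LINT \<theta>|circle_measure. indicator (arc_of (right_half J)) \<theta> * f \<theta>"
  have half: "arc_len (left_half J) = arc_len J / 2" "arc_len (right_half J) = arc_len J / 2"
  proof -
    have "fst (left_half J) = Suc (fst J)" "fst (right_half J) = Suc (fst J)"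
      by (cases J; simp)+
    then show "arc_len (left_half J) = arc_len J / 2" "arc_len (right_half J) = arc_len J / 2"
      by (simp_all add: arc_len_eq dyadic_lattice.intros assms(2))
  qed
  have pos: "0 < arc_len J"
    using assms(2) by (simp add: arc_len_eq)
  have l: "haar_coeff f J = 1 / sqrt (arc_len J) * (?l - ?r)"
    unfolding haar_coeff_def haar_mult_eq[OF assms(2)]
    by (simp add: Bochner_Integration.integral_diff integrable_arc dyadic_lattice.intros assms)
  have "avg_jump f J = 2 / arc_len J * (?r - ?l)"
    by (simp add: avg_def set_lebesgue_integral_def half right_diff_distrib)
  then have "- sqrt (arc_len J) / 2 * avg_jump f J = sqrt (arc_len J) / arc_len J * (?l - ?r)"
    using pos by (simp only:) (simp add: right_diff_distrib diff_divide_distrib)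
  moreover have "sqrt (arc_len J) / arc_len J = 1 / sqrt (arc_len J)"
    using pos by (simp add: sqrt_divide_self_eq inverse_eq_divide)
  ultimately show ?thesis
    using l by (simp only:)
qed

lemma haar_coeff_add:
  fixes f :: "complex \<Rightarrow> real"
  assumes "integrable circle_measure f" "integrable circle_measure g" "J \<in> dyadic_lattice"
  shows "haar_coeff (\<lambda>\<theta>. f \<theta> + g \<theta>) J = haar_coeff f J + haar_coeff g J"
  unfolding haar_coeff_def distrib_right
  by (intro Bochner_Integration.integral_add integrable_mult_haar assms)

lemma haar_coeff_cmult: "haar_coeff (\<lambda>\<theta>. c * f \<theta>) J = c * haar_coeff f J"
  by (simp add: haar_coeff_def mult.assoc)

lemma abs_haar_coeff_mult:
  fixes f :: "complex \<Rightarrow> real"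
  assumes "integrable circle_measure f" "integrable circle_measure g" "J \<in> dyadic_lattice"
  shows "\<bar>haar_coeff f J\<bar> * \<bar>haar_coeff g J\<bar> = 1 / 4 * (arc_len J * \<bar>avg_jump f J\<bar> * \<bar>avg_jump g J\<bar>)"
proof -
  have sq: "sqrt (arc_len J) * sqrt (arc_len J) = arc_len J"
    using assms by (simp add: arc_len_eq)
  have abs: "\<bar>haar_coeff h J\<bar> = sqrt (arc_len J) / 2 * \<bar>avg_jump h J\<bar>"
    if "integrable circle_measure h" for h
    using assms(3) by (simp add: haar_coeff_eq that abs_mult arc_len_eq)
  have "\<bar>haar_coeff f J\<bar> * \<bar>haar_coeff g J\<bar>
      = 1 / 4 * ((sqrt (arc_len J) * sqrt (arc_len J)) * \<bar>avg_jump f J\<bar> * \<bar>avg_jump g J\<bar>)"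
    unfolding abs[OF assms(1)] abs[OF assms(2)] by simp
  with sq show ?thesis by (simp only:)
qed

section \<open>From the tree to the two norms\<close>

lemma summable_on_ennreal_fun: "(f :: 'a \<Rightarrow> ennreal) summable_on A"
  by (rule nonneg_summable_on_complete) simp

lemma ennsqrt_mono: "x \<le> y \<Longrightarrow> ennsqrt x \<le> ennsqrt y"
  by (auto simp: ennsqrt_def top_unique less_top intro!: ennreal_leI enn2real_mono)

lemma ennsqrt_ennreal: "0 \<le> x \<Longrightarrow> ennsqrt (ennreal x) = ennreal (sqrt x)"
  by (simp add: ennsqrt_def)

lemma ennsqrt_le_iff:
  assumes "0 \<le> B"
  shows "ennsqrt x \<le> ennreal B \<longleftrightarrow> x \<le> ennreal (B\<^sup>2)"
proof (cases x)
  case (real r)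
  then show ?thesis
    using assms by (simp add: ennsqrt_ennreal ennreal_le_iff real_sqrt_le_iff' sqrt_le_D real_le_lsqrt)
qed (simp add: ennsqrt_def top_unique)

lemma arc_of_ancestor:
  assumes "\<theta> \<in> arc_of (n + m, k)"
  shows "\<theta> \<in> arc_of (n, k div 2 ^ m)"
  using assms
proof (induction m arbitrary: k)
  case (Suc m)
  have "\<theta> \<in> arc_of (n + m, k div 2)"
    using Suc.prems arc_of_halves[of "(n + m, k div 2)"]
    by (cases "even k") (auto)
  then show ?case
    using Suc.IH[of "k div 2"] by (simp add: div_mult2_eq)
qed simp

text \<open>
  The arcs that contain \<open>\<theta>\<close> include \<open>(n, k)\<close> and its \<open>n\<close> proper ancestors.
\<close>
lemma path_sqrt_le_square_function:
  assumes "k < 2 ^ n" "\<theta> \<in> arc_of (n, k)"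
  shows "ennreal (path_sqrt a (n, k)) \<le>
    ennsqrt (\<Sum>\<^sub>\<infinity>I\<in>{I \<in> dyadic_lattice. \<theta> \<in> arc_of I}. ennreal ((a I)\<^sup>2))"
proof -
  let ?A = "{I \<in> dyadic_lattice. \<theta> \<in> arc_of I}"
  let ?p = "\<lambda>j. (j, k div 2 ^ (n - j))"
  have p: "?p ` {..n} \<subseteq> ?A"
  proof (rule image_subsetI)
    fix j assume "j \<in> {..n}"
    then have n: "n = j + (n - j)" by simp
    then have "k < 2 ^ (n - j) * 2 ^ j"
      using assms(1) by (metis power_add mult.commute)
    then have "k div 2 ^ (n - j) < 2 ^ j"
      by (simp add: less_mult_imp_div_less mult.commute)
    moreover have "\<theta> \<in> arc_of (j, k div 2 ^ (n - j))"
      using n assms(2) by (metis arc_of_ancestor)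
    ultimately show "?p j \<in> ?A"
      by (simp add: mem_dyadic_lattice_iff)
  qed
  have "ennreal (\<Sum>j\<le>n. (a (?p j))\<^sup>2) = (\<Sum>I\<in>?p ` {..n}. ennreal ((a I)\<^sup>2))"
    by (subst sum.reindex) (auto simp: inj_on_def sum_ennreal)
  also have "\<dots> = (\<Sum>\<^sub>\<infinity>I\<in>?p ` {..n}. ennreal ((a I)\<^sup>2))"
    by simp
  also have "\<dots> \<le> (\<Sum>\<^sub>\<infinity>I\<in>?A. ennreal ((a I)\<^sup>2))"
    using p by (intro infsum_mono_neutral summable_on_ennreal_fun) auto
  finally show ?thesis
    using ennsqrt_mono by (fastforce simp: path_sqrt_def ennsqrt_ennreal[symmetric] sum_nonneg)
qed

text \<open>
  On each arc of level \<open>n\<close> the full square function dominates its truncation at that arc, and the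
  arcs of level \<open>n\<close> are disjoint, so it dominates the corresponding simple function on the circle.
\<close>
lemma level_mean_le_F1_norm: "ennreal (level_mean (path_sqrt (avg_jump f)) n) \<le> F1_norm f"
proof -
  let ?s = "\<lambda>k. path_sqrt (avg_jump f) (n, k)"
  have "ennreal (level_mean (path_sqrt (avg_jump f)) n)
      = (\<Sum>k<2 ^ n. ennreal (?s k) * emeasure circle_measure (arc_of (n, k)))"
    unfolding level_mean_def
    by (subst sum_ennreal[symmetric])
      (auto simp: emeasure_arc_of mem_dyadic_lattice_iff ennreal_mult[symmetric] intro!: sum.cong)
  also have "\<dots> = (\<Sum>k<2 ^ n. \<integral>\<^sup>+\<theta>. ennreal (?s k) * indicator (arc_of (n, k)) \<theta> \<partial>circle_measure)"
    by (intro sum.cong refl nn_integral_cmult_indicator[symmetric] sets_arc_of)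
      (simp add: mem_dyadic_lattice_iff)
  also have "\<dots> = (\<integral>\<^sup>+\<theta>. (\<Sum>k<2 ^ n. ennreal (?s k) * indicator (arc_of (n, k)) \<theta>) \<partial>circle_measure)"
    by (intro nn_integral_sum[symmetric] borel_measurable_times_ennreal borel_measurable_indicator sets_arc_of)
      (auto simp: mem_dyadic_lattice_iff)
  also have "\<dots> \<le> F1_norm f"
    unfolding F1_norm_def
  proof (intro nn_integral_mono)
    fix \<theta>
    let ?rhs = "ennsqrt (\<Sum>\<^sub>\<infinity>I\<in>{I \<in> dyadic_lattice. \<theta> \<in> arc_of I}. ennreal ((avg_jump f I)\<^sup>2))"
    show "(\<Sum>k<2 ^ n. ennreal (?s k) * indicator (arc_of (n, k)) \<theta>) \<le> ?rhs"
    proof (cases "\<exists>k<2 ^ n. \<theta> \<in> arc_of (n, k)")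
      case True
      then obtain k where k: "k < 2 ^ n" "\<theta> \<in> arc_of (n, k)" by blast
      have "(\<Sum>l<2 ^ n. ennreal (?s l) * indicator (arc_of (n, l)) \<theta>)
          = (\<Sum>l<2 ^ n. if l = k then ennreal (?s l) else 0)"
        using k arc_of_disjoint[of _ n k]
        by (intro sum.cong) (auto split: split_indicator)
      also have "\<dots> = ennreal (?s k)"
        using k(1) by simp
      also have "\<dots> \<le> ?rhs"
        by (rule path_sqrt_le_square_function[OF k])
      finally show ?thesis .
    next
      case False
      then show ?thesis by (simp)
    qed
  qed
  finally show ?thesis .
qed

text \<open>
  The sum in the definition of the BMO norm, before the normalization by the length of \<open>J\<close>.
\<close>
definition Carleson_mass :: "(complex \<Rightarrow> real) \<Rightarrow> dyadic \<Rightarrow> ennreal" where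
  "Carleson_mass \<phi> J = (\<Sum>\<^sub>\<infinity>I\<in>{I \<in> dyadic_lattice. arc_of I \<subseteq> arc_of J}.
     ennreal ((avg_jump \<phi> I)\<^sup>2 * arc_len I))"

text \<open>
  The halves are disjoint and nonempty, so an arc lies inside at most one of them, and \<open>J\<close> itself
  lies inside neither: the three families of arcs on the left are disjoint.
\<close>
lemma Carleson_mass_split:
  assumes J: "J \<in> dyadic_lattice"
  shows "ennreal ((avg_jump \<phi> J)\<^sup>2 * arc_len J) + Carleson_mass \<phi> (left_half J) + Carleson_mass \<phi> (right_half J)
    \<le> Carleson_mass \<phi> J"
proof -
  let ?D = "\<lambda>J. {I \<in> dyadic_lattice. arc_of I \<subseteq> arc_of J}"
  let ?g = "\<lambda>I. ennreal ((avg_jump \<phi> I)\<^sup>2 * arc_len I)"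
  note disj = halves_disjoint[OF J] and split = arc_of_halves[of J]
  have 1: "?D (left_half J) \<inter> ?D (right_half J) = {}"
    using disj arc_of_nonempty by blast
  have 2: "{J} \<inter> (?D (left_half J) \<union> ?D (right_half J)) = {}"
    using disj split arc_of_nonempty[of "left_half J"] arc_of_nonempty[of "right_half J"] by auto
  have 3: "{J} \<union> (?D (left_half J) \<union> ?D (right_half J)) \<subseteq> ?D J"
    using J split by auto
  have "infsum ?g ({J} \<union> (?D (left_half J) \<union> ?D (right_half J)))
      = infsum ?g {J} + infsum ?g (?D (left_half J) \<union> ?D (right_half J))"
    by (rule infsum_Un_disjoint[OF summable_on_ennreal_fun summable_on_ennreal_fun 2])
  also have "infsum ?g (?D (left_half J) \<union> ?D (right_half J))
      = infsum ?g (?D (left_half J)) + infsum ?g (?D (right_half J))"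
    by (rule infsum_Un_disjoint[OF summable_on_ennreal_fun summable_on_ennreal_fun 1])
  finally have "?g J + Carleson_mass \<phi> (left_half J) + Carleson_mass \<phi> (right_half J)
      = infsum ?g ({J} \<union> (?D (left_half J) \<union> ?D (right_half J)))"
    by (simp only: Carleson_mass_def infsum_finite finite.intros sum.insert) (simp add: add.assoc)
  also have "\<dots> \<le> infsum ?g (?D J)"
    using 3 by (intro infsum_mono_neutral summable_on_ennreal_fun) auto
  finally show ?thesis by (simp add: Carleson_mass_def)
qed

lemma Carleson_mass_le:
  assumes "J \<in> dyadic_lattice" "BMOd_norm \<phi> \<le> ennreal B" "0 \<le> B"
  shows "Carleson_mass \<phi> J \<le> ennreal (B\<^sup>2 * arc_len J)"
proof -
  have len: "0 < arc_len J"
    using assms(1) by (simp add: arc_len_eq)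
  have "ennsqrt (ennreal (1 / arc_len J) * Carleson_mass \<phi> J) \<le> BMOd_norm \<phi>"
    unfolding BMOd_norm_def Carleson_mass_def by (rule SUP_upper[OF assms(1)])
  then have "ennreal (1 / arc_len J) * Carleson_mass \<phi> J \<le> ennreal (B\<^sup>2)"
    using assms by (simp add: ennsqrt_le_iff[symmetric])
  then have le: "ennreal (arc_len J) * (ennreal (1 / arc_len J) * Carleson_mass \<phi> J)
      \<le> ennreal (arc_len J) * ennreal (B\<^sup>2)"
    by (rule mult_left_mono) simp
  have "ennreal (arc_len J) * ennreal (1 / arc_len J) = 1"
    using len by (simp add: ennreal_mult[symmetric])
  then have "Carleson_mass \<phi> J = ennreal (arc_len J) * (ennreal (1 / arc_len J) * Carleson_mass \<phi> J)"
    by (simp only: mult.assoc[symmetric] mult_1_left)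
  also note le
  also have "ennreal (arc_len J) * ennreal (B\<^sup>2) = ennreal (B\<^sup>2 * arc_len J)"
    using len by (subst ennreal_mult[symmetric]) (simp_all add: mult.commute)
  finally show ?thesis .
qed

text \<open>
  Any finite family of arcs lies in the first \<open>N\<close> levels for some \<open>N\<close>, where the duality estimate on
  the tree applies, with the Carleson mass of \<open>\<phi>\<close> as the bound \<open>T\<close>.
\<close>
lemma infsum_avg_jump_le:
  assumes B: "BMOd_norm \<phi> \<le> ennreal B" "0 \<le> B" and F: "F1_norm f \<le> ennreal F" "0 \<le> F"
  shows "(\<Sum>\<^sub>\<infinity>J\<in>dyadic_lattice. ennreal (arc_len J * \<bar>avg_jump f J\<bar> * \<bar>avg_jump \<phi> J\<bar>))
    \<le> ennreal (sqrt 2 * B * F)"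
proof (rule infsum_le_finite_sums)
  let ?w = "\<lambda>J. arc_len J * \<bar>avg_jump f J\<bar> * \<bar>avg_jump \<phi> J\<bar>"
  define T where "T J = enn2real (Carleson_mass \<phi> J)" for J
  fix A assume A: "finite A" "A \<subseteq> dyadic_lattice"
  have T_eq: "Carleson_mass \<phi> J = ennreal (T J)" if "J \<in> dyadic_lattice" for J
    using le_less_trans[OF Carleson_mass_le[OF that B] ennreal_less_top] that by (simp add: T_def)
  have T_nonneg: "0 \<le> T J" for J
    by (simp add: T_def)
  obtain N where N: "\<And>J. J \<in> A \<Longrightarrow> fst J \<le> N"
    using finite_nat_set_iff_bounded_le[of "fst ` A"] A(1) by auto
  then have sub: "A \<subseteq> Sigma {..N} (\<lambda>n. {..<2 ^ n})"
    using A(2) by (fastforce simp: mem_dyadic_lattice_iff)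
  have "sum ?w A \<le> sum ?w (Sigma {..N} (\<lambda>n. {..<2 ^ n}))"
    by (rule sum_mono2[OF _ sub]) (auto simp: arc_len_def)
  also have "\<dots> = (\<Sum>n\<le>N. \<Sum>k<2 ^ n. ?w (n, k))"
    by (subst sum.Sigma) (simp_all add: case_prod_unfold del: left_half.simps right_half.simps)
  also have "\<dots> = (\<Sum>n\<le>N. level_mean (\<lambda>J. \<bar>avg_jump f J\<bar> * \<bar>avg_jump \<phi> J\<bar>) n)"
    unfolding level_mean_def
    by (intro sum.cong refl) (simp add: arc_len_eq mem_dyadic_lattice_iff)
  also have "\<dots> \<le> sqrt 2 * B * level_mean (path_sqrt (avg_jump f)) N"
  proof (rule dyadic_duality[where T = T])
    fix n k :: nat assume "k < 2 ^ n"
    then have J: "(n, k) \<in> dyadic_lattice" by (simp add: mem_dyadic_lattice_iff)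
    note halves = dyadic_lattice.left[OF J] dyadic_lattice.right[OF J]
    show "(avg_jump \<phi> (n, k))\<^sup>2 / 2 ^ n + T (Suc n, 2 * k) + T (Suc n, 2 * k + 1) \<le> T (n, k)"
      using Carleson_mass_split[OF J, of \<phi>] unfolding T_eq[OF J] T_eq[OF halves(1)] T_eq[OF halves(2)]
      by (simp add: arc_len_eq[OF J] T_nonneg ennreal_plus[symmetric] del: ennreal_plus)
    show "T (n, k) \<le> B\<^sup>2 / 2 ^ n"
      using Carleson_mass_le[OF J B] unfolding T_eq[OF J] by (simp add: arc_len_eq[OF J])
  qed (use B in \<open>auto simp: T_def\<close>)
  also have "level_mean (path_sqrt (avg_jump f)) N \<le> F"
    using order.trans[OF level_mean_le_F1_norm F(1), of N] F(2) by (simp add: ennreal_le_iff)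
  finally have "sum ?w A \<le> sqrt 2 * B * F"
    using B(2) by (simp add: mult_left_mono)
  then show "(\<Sum>J\<in>A. ennreal (?w J)) \<le> ennreal (sqrt 2 * B * F)"
    by (subst sum_ennreal) (auto simp: arc_len_def intro: ennreal_leI)
qed (rule summable_on_ennreal_fun)

section \<open>The functional defined by a BMO function\<close>

lemma infsum_cmult_ennreal:
  fixes g :: "'a \<Rightarrow> ennreal"
  shows "(\<Sum>\<^sub>\<infinity>x\<in>A. c * g x) = c * (\<Sum>\<^sub>\<infinity>x\<in>A. g x)"
  by (simp add: nonneg_infsum_complete SUP_mult_left_ennreal sum_distrib_left)

lemma
  fixes x :: "'a \<Rightarrow> real"
  assumes nonneg: "\<And>i. i \<in> A \<Longrightarrow> 0 \<le> x i" and "0 \<le> C"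
    and le: "(\<Sum>\<^sub>\<infinity>i\<in>A. ennreal (x i)) \<le> ennreal C"
  shows summable_on_if_infsum_ennreal_le: "x summable_on A"
    and infsum_le_if_infsum_ennreal_le: "infsum x A \<le> C"
proof -
  have fin: "sum x F \<le> C" if "finite F" "F \<subseteq> A" for F
  proof -
    have "ennreal (sum x F) = (\<Sum>\<^sub>\<infinity>i\<in>F. ennreal (x i))"
      using that nonneg by (simp add: sum_ennreal subset_iff)
    also have "\<dots> \<le> (\<Sum>\<^sub>\<infinity>i\<in>A. ennreal (x i))"
      using that by (intro infsum_mono_neutral summable_on_ennreal_fun) auto
    finally show ?thesis
      using le \<open>0 \<le> C\<close> by (metis ennreal_le_iff order.trans)
  qed
  show "x summable_on A"
    by (rule nonneg_bdd_above_summable_on[OF nonneg])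
      (auto intro!: bdd_aboveI2[where M = C] fin)
  then show "infsum x A \<le> C"
    by (rule infsum_le_finite_sums) (rule fin)
qed

lemma infsum_haar_coeff_eq:
  assumes "integrable circle_measure f" "integrable circle_measure \<phi>"
  shows "(\<Sum>\<^sub>\<infinity>J\<in>dyadic_lattice. ennreal (\<bar>haar_coeff f J\<bar> * \<bar>haar_coeff \<phi> J\<bar>))
    = ennreal (1 / 4) * (\<Sum>\<^sub>\<infinity>J\<in>dyadic_lattice. ennreal (arc_len J * \<bar>avg_jump f J\<bar> * \<bar>avg_jump \<phi> J\<bar>))"
  unfolding infsum_cmult_ennreal[symmetric]
proof (rule infsum_cong)
  fix J assume "J \<in> dyadic_lattice"
  then show "ennreal (\<bar>haar_coeff f J\<bar> * \<bar>haar_coeff \<phi> J\<bar>)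
      = ennreal (1 / 4) * ennreal (arc_len J * \<bar>avg_jump f J\<bar> * \<bar>avg_jump \<phi> J\<bar>)"
    by (subst ennreal_mult[symmetric]) (simp_all add: abs_haar_coeff_mult[OF assms] arc_len_eq)
qed

theorem lemma2p2:
  fixes \<phi> :: "complex \<Rightarrow> real"
  assumes "\<phi> \<in> BMOd_space"
  shows "(\<forall>f\<in>F1_space.
      (\<Sum>\<^sub>\<infinity>J\<in>dyadic_lattice. ennreal (\<bar>haar_coeff f J\<bar> * \<bar>haar_coeff \<phi> J\<bar>)) =
        ennreal (1 / 4) * (\<Sum>\<^sub>\<infinity>J\<in>dyadic_lattice. ennreal (arc_len J *
          \<bar>avg f (right_half J) - avg f (left_half J)\<bar> *
          \<bar>avg \<phi> (right_half J) - avg \<phi> (left_half J)\<bar>)) \<and>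
      ennreal (1 / 4) * (\<Sum>\<^sub>\<infinity>J\<in>dyadic_lattice. ennreal (arc_len J *
          \<bar>avg f (right_half J) - avg f (left_half J)\<bar> *
          \<bar>avg \<phi> (right_half J) - avg \<phi> (left_half J)\<bar>))
        \<le> ennreal (sqrt 2 / 4) * BMOd_norm \<phi> * F1_norm f \<and>
      (\<lambda>J. \<bar>haar_coeff f J * haar_coeff \<phi> J\<bar>) summable_on dyadic_lattice) \<and>
    (\<lambda>f. \<Sum>\<^sub>\<infinity>J\<in>dyadic_lattice. haar_coeff f J * haar_coeff \<phi> J) \<in> F1_dual"
proof -
  define B where "B = enn2real (BMOd_norm \<phi>)"
  have B: "BMOd_norm \<phi> = ennreal B" "0 \<le> B" and \<phi>: "integrable circle_measure \<phi>"
    using assms by (auto simp: B_def BMOd_space_def)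
  let ?L = "\<lambda>f. \<Sum>\<^sub>\<infinity>J\<in>dyadic_lattice. haar_coeff f J * haar_coeff \<phi> J"
  have bound: "ennreal (1 / 4) * (\<Sum>\<^sub>\<infinity>J\<in>dyadic_lattice. ennreal (arc_len J * \<bar>avg_jump f J\<bar> * \<bar>avg_jump \<phi> J\<bar>))
      \<le> ennreal (sqrt 2 / 4 * B * F)"
    if "F1_norm f = ennreal F" "0 \<le> F" for f F
  proof -
    have "ennreal (1 / 4) * (\<Sum>\<^sub>\<infinity>J\<in>dyadic_lattice. ennreal (arc_len J * \<bar>avg_jump f J\<bar> * \<bar>avg_jump \<phi> J\<bar>))
        \<le> ennreal (1 / 4) * ennreal (sqrt 2 * B * F)"
      using B that by (intro mult_left_mono infsum_avg_jump_le) auto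
    also have "\<dots> = ennreal (sqrt 2 / 4 * B * F)"
      using B that by (subst ennreal_mult[symmetric]) auto
    finally show ?thesis .
  qed
  have pairing: "(\<lambda>J. \<bar>haar_coeff f J * haar_coeff \<phi> J\<bar>) summable_on dyadic_lattice"
      "\<bar>?L f\<bar> \<le> sqrt 2 / 4 * B * F"
    if "integrable circle_measure f" "F1_norm f = ennreal F" "0 \<le> F" for f F
  proof -
    have le: "(\<Sum>\<^sub>\<infinity>J\<in>dyadic_lattice. ennreal \<bar>haar_coeff f J * haar_coeff \<phi> J\<bar>)
        \<le> ennreal (sqrt 2 / 4 * B * F)"
      using bound[OF that(2,3)] by (simp add: infsum_haar_coeff_eq[OF that(1) \<phi>] abs_mult)
    have nonneg: "0 \<le> sqrt 2 / 4 * B * F" using B that by simp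
    show sm: "(\<lambda>J. \<bar>haar_coeff f J * haar_coeff \<phi> J\<bar>) summable_on dyadic_lattice"
      by (rule summable_on_if_infsum_ennreal_le[OF _ nonneg le]) simp
    have "\<bar>?L f\<bar> \<le> (\<Sum>\<^sub>\<infinity>J\<in>dyadic_lattice. \<bar>haar_coeff f J * haar_coeff \<phi> J\<bar>)"
      using norm_infsum_bound[of "\<lambda>J. haar_coeff f J * haar_coeff \<phi> J"] sm by simp
    also have "\<dots> \<le> sqrt 2 / 4 * B * F"
      by (rule infsum_le_if_infsum_ennreal_le[OF _ nonneg le]) simp
    finally show "\<bar>?L f\<bar> \<le> sqrt 2 / 4 * B * F" .
  qed
  have F1: "integrable circle_measure f" "\<exists>F\<ge>0. F1_norm f = ennreal F" if "f \<in> F1_space" for f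
  proof -
    from that show "integrable circle_measure f" by (simp add: F1_space_def)
    from that have "F1_norm f < top" by (simp add: F1_space_def)
    then show "\<exists>F\<ge>0. F1_norm f = ennreal F" by (cases "F1_norm f") auto
  qed
  have abs_summable: "(\<lambda>J. \<bar>haar_coeff f J * haar_coeff \<phi> J\<bar>) summable_on dyadic_lattice"
    if f: "f \<in> F1_space" for f
  proof -
    obtain F where "F1_norm f = ennreal F" "0 \<le> F"
      using F1(2)[OF f] by blast
    then show ?thesis
      by (rule pairing(1)[OF F1(1)[OF f]])
  qed
  have summable: "(\<lambda>J. haar_coeff f J * haar_coeff \<phi> J) summable_on dyadic_lattice"
    if "f \<in> F1_space" for f
    using abs_summable[OF that] by (simp add: abs_summable_summable)
  have add: "?L (\<lambda>\<theta>. f \<theta> + g \<theta>) = ?L f + ?L g" if fg: "f \<in> F1_space" "g \<in> F1_space" for f g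
  proof -
    have "?L (\<lambda>\<theta>. f \<theta> + g \<theta>)
        = (\<Sum>\<^sub>\<infinity>J\<in>dyadic_lattice. haar_coeff f J * haar_coeff \<phi> J + haar_coeff g J * haar_coeff \<phi> J)"
      by (intro infsum_cong) (simp add: haar_coeff_add F1(1) fg distrib_right)
    also have "\<dots> = ?L f + ?L g"
      by (intro infsum_add summable fg)
    finally show ?thesis .
  qed
  have "?L \<in> F1_dual"
    unfolding F1_dual_def mem_Collect_eq
  proof (intro conjI ballI allI impI)
    fix f g assume "f \<in> F1_space" "g \<in> F1_space"
    then show "?L (\<lambda>\<theta>. f \<theta> + g \<theta>) = ?L f + ?L g" by (rule add)
  next
    fix c f
    show "?L (\<lambda>\<theta>. c * f \<theta>) = c * ?L f"
      by (simp add: haar_coeff_cmult mult.assoc infsum_cmult_right')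
  next
    fix f and \<epsilon> :: real assume f: "f \<in> F1_space" and "0 < \<epsilon>"
    \<comment> \<open>The summand 1 keeps the denominator positive when \<open>\<phi>\<close> has BMO norm 0.\<close>
    define \<delta> where "\<delta> = \<epsilon> / (sqrt 2 / 4 * B + 1)"
    have \<delta>: "0 < \<delta>" and \<delta>_bound: "sqrt 2 / 4 * B * \<delta> < \<epsilon>"
    proof -
      have pos: "0 < sqrt 2 / 4 * B + 1" using B by (simp add: add_nonneg_pos)
      then show "0 < \<delta>" using \<open>0 < \<epsilon>\<close> by (simp add: \<delta>_def)
      moreover have "(sqrt 2 / 4 * B + 1) * \<delta> = \<epsilon>" using pos by (simp add: \<delta>_def)
      ultimately show "sqrt 2 / 4 * B * \<delta> < \<epsilon>" by (simp add: distrib_right)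
    qed
    show "\<exists>\<delta>>0. \<forall>g\<in>F1_space. F1_norm (\<lambda>\<theta>. g \<theta> - f \<theta>) < ennreal \<delta> \<longrightarrow> \<bar>?L g - ?L f\<bar> < \<epsilon>"
    proof (intro exI[of _ \<delta>] conjI ballI impI \<delta>)
      fix g assume g: "g \<in> F1_space" and close: "F1_norm (\<lambda>\<theta>. g \<theta> - f \<theta>) < ennreal \<delta>"
      let ?d = "\<lambda>\<theta>. g \<theta> - f \<theta>"
      obtain F where F: "F1_norm ?d = ennreal F" "0 \<le> F" "F < \<delta>"
        using close by (cases "F1_norm ?d") (auto simp: ennreal_less_iff)
      have int: "integrable circle_measure ?d"
        using F1(1)[OF f] F1(1)[OF g] by simp
      \<comment> \<open>The difference has finite norm because it is close to 0, which replaces a triangle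
        inequality for the norm.\<close>
      have "?d \<in> F1_space"
        using int F by (simp add: F1_space_def)
      then have "?L g = ?L ?d + ?L f"
        using add[of ?d f] f by simp
      then have "\<bar>?L g - ?L f\<bar> \<le> sqrt 2 / 4 * B * F"
        using pairing(2)[OF int F(1,2)] by simp
      also have "\<dots> \<le> sqrt 2 / 4 * B * \<delta>"
        using B F by (intro mult_left_mono) auto
      finally show "\<bar>?L g - ?L f\<bar> < \<epsilon>"
        using \<delta>_bound by simp
    qed
  qed
  moreover have "ennreal (1 / 4) * (\<Sum>\<^sub>\<infinity>J\<in>dyadic_lattice. ennreal (arc_len J * \<bar>avg_jump f J\<bar> * \<bar>avg_jump \<phi> J\<bar>))
      \<le> ennreal (sqrt 2 / 4) * BMOd_norm \<phi> * F1_norm f" if f: "f \<in> F1_space" for f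
  proof -
    obtain F where F: "F1_norm f = ennreal F" "0 \<le> F"
      using F1(2)[OF f] by blast
    then have "ennreal (sqrt 2 / 4) * BMOd_norm \<phi> * F1_norm f = ennreal (sqrt 2 / 4 * B * F)"
      using B by (simp add: ennreal_mult[symmetric])
    then show ?thesis
      using bound[OF F] by simp
  qed
  ultimately show ?thesis
    by (intro conjI ballI infsum_haar_coeff_eq[OF F1(1) \<phi>] abs_summable)
qed

end
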